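(* Let $n>1$ and let $\phi\colon X\to\mathfrak{u}(n)\oplus\mathfrak{gl}(n,\mathbb{C})$, where $X=\operatorname{Hom}_{\mathbb{C}}(\mathbb{C}^n,\mathbb{C}^n)\oplus\operatorname{Hom}_{\mathbb{C}}(\mathbb{C}^n,\mathbb{C}^n)$, be the map $$\phi(A,B)=\left(\tfrac{i}{2}(A^*A-BB^* ),\,BA\right).$$ Then there exist critical values $(0,S)$ of $\phi$ with $S\in\mathfrak{gl}(n,\mathbb{C})$ invertible for which the fibre $\phi^{-1}(0,S)$ has (real) dimension strictly greater than $n^2$.
   Context: $A^*$ denotes the conjugate transpose. A critical value of $\phi$ is the image of a critical point, i.e. of a point where the real differential $d\phi$ is not surjective. The fibres of $\phi$ are real algebraic subsets of the real vector space $X$ of dimension $4n^2$, and dimension means dimension of a real algebraic set. *)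

theory Defs
  imports "HOL-Analysis.Analysis" "HOL-Algebra.Ideal" "HOL-Library.Extended_Real"
begin

definition conj_transpose :: "complex^'n^'m \<Rightarrow> complex^'m^'n" where
  "conj_transpose A = map_matrix cnj (transpose A)"

definition unitary_algebra :: "(complex^'n^'n) set" where
  "unitary_algebra = {M. conj_transpose M = - M}"

text \<open>
  The map \<open>\<phi>\<close>. The library has no type for \<open>u(n)\<close>, so its first component is typed as a
  matrix; \<open>phi_in_unitary_algebra\<close> shows that it takes values in \<open>u(n) \<oplus> gl(n, C)\<close>.
\<close>

definition phi ::
  "(complex^'n^'n) \<times> (complex^'n^'n) \<Rightarrow> (complex^'n^'n) \<times> (complex^'n^'n)" where
  "phi = (\<lambda>(A, B).
     (map_matrix (\<lambda>z. \<i> / 2 * z) (conj_transpose A ** A - B ** conj_transpose B), B ** A))"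

lemma phi_in_unitary_algebra: "phi p \<in> unitary_algebra \<times> UNIV"
  by (cases p) (auto simp: phi_def unitary_algebra_def conj_transpose_def vec_eq_iff
      matrix_matrix_mult_def transpose_def field_simps sum_negf intro!: sum.cong)

text \<open>
  Critical points and values of a map with values in a real vector subspace \<open>W\<close>: the real
  differential is to be surjective onto \<open>W\<close>, not onto the ambient space.
\<close>

definition critical_point ::
  "'b set \<Rightarrow> ('a::real_normed_vector \<Rightarrow> 'b::real_normed_vector) \<Rightarrow> 'a \<Rightarrow> bool" where
  "critical_point W f x \<longleftrightarrow>
     f differentiable (at x) \<and> range (frechet_derivative f (at x)) \<noteq> W"

definition critical_values ::
  "'b set \<Rightarrow> ('a::real_normed_vector \<Rightarrow> 'b::real_normed_vector) \<Rightarrow> 'b set" where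
  "critical_values W f = f ` {x. critical_point W f x}"

text \<open>
  The ring of real polynomial functions on \<open>V\<close>. Restriction to \<open>V\<close> identifies it with the
  quotient of the real polynomial ring of the ambient space by the ideal of \<open>V\<close>.
\<close>

definition coordinate_ring :: "'a::real_normed_vector set \<Rightarrow> ('a \<Rightarrow> real) ring" where
  "coordinate_ring V =
     \<lparr>carrier = {restrict f V | f. real_polynomial_function f},
      mult = (\<lambda>f g. restrict (\<lambda>x. f x * g x) V),
      one = restrict (\<lambda>x. 1) V,
      zero = restrict (\<lambda>x. 0) V,
      add = (\<lambda>f g. restrict (\<lambda>x. f x + g x) V)\<rparr>"

text \<open>
  Supremum of the lengths \<open>d\<close> of chains \<open>P 0 \<subset> \<dots> \<subset> P d\<close> of prime ideals. It lives in the
  extended reals so that the zero ring, and hence the empty set, gets dimension \<open>-\<infinity>\<close>.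
\<close>

definition krull_dim :: "('a, 'b) ring_scheme \<Rightarrow> ereal" where
  "krull_dim R = Sup {ereal (real d) | d.
     \<exists>P. (\<forall>k\<le>d. primeideal (P k) R) \<and> (\<forall>k<d. P k \<subset> P (Suc k))}"

text \<open>
  The dimension of a real algebraic set, in the sense of Bochnak, Coste and Roy.
\<close>

definition real_algebraic_dim :: "'a::euclidean_space set \<Rightarrow> ereal" where
  "real_algebraic_dim V = krull_dim (coordinate_ring V)"

lemma cring_coordinate_ring: "cring (coordinate_ring V)"
proof -
  have neg: "real_polynomial_function (\<lambda>x. - f x)"
    if "real_polynomial_function f" for f :: "'a \<Rightarrow> real"
    using real_polynomial_function.intros(4)[OF real_polynomial_function.intros(2)[of "-1"] that] by simp
  have closed: "restrict (\<lambda>x. f x + g x) V \<in> carrier (coordinate_ring V)"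
      "restrict (\<lambda>x. f x * g x) V \<in> carrier (coordinate_ring V)"
    if fg: "f \<in> carrier (coordinate_ring V)" "g \<in> carrier (coordinate_ring V)" for f g
  proof -
    obtain p q where p: "real_polynomial_function p" "f = restrict p V"
      and q: "real_polynomial_function q" "g = restrict q V"
      using fg by (auto simp: coordinate_ring_def)
    have "restrict (\<lambda>x. f x + g x) V = restrict (\<lambda>x. p x + q x) V"
      "restrict (\<lambda>x. f x * g x) V = restrict (\<lambda>x. p x * q x) V"
      using p q by (auto simp: fun_eq_iff restrict_def)
    then show "restrict (\<lambda>x. f x + g x) V \<in> carrier (coordinate_ring V)"
      "restrict (\<lambda>x. f x * g x) V \<in> carrier (coordinate_ring V)"
      unfolding coordinate_ring_def using p(1) q(1) by auto
  qed
  have inv: "\<exists>y\<in>carrier (coordinate_ring V). restrict (\<lambda>x. y x + f x) V = restrict (\<lambda>x. 0) V"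
    if f: "f \<in> carrier (coordinate_ring V)" for f
  proof -
    obtain p where p: "real_polynomial_function p" "f = restrict p V"
      using f by (auto simp: coordinate_ring_def)
    have "restrict (\<lambda>x. - p x) V \<in> carrier (coordinate_ring V)"
      using neg[OF p(1)] by (auto simp: coordinate_ring_def)
    moreover have "restrict (\<lambda>x. restrict (\<lambda>x. - p x) V x + f x) V = restrict (\<lambda>x. 0) V"
      using p by (auto simp: fun_eq_iff restrict_def)
    ultimately show ?thesis by blast
  qed
  have cst: "restrict (\<lambda>x. c) V \<in> carrier (coordinate_ring V)" for c
    by (auto simp: coordinate_ring_def)
  have ext: "f x = undefined" if "f \<in> carrier (coordinate_ring V)" "x \<notin> V" for f x
    using that by (auto simp: coordinate_ring_def)
  have ops: "\<And>f g. f \<oplus>\<^bsub>coordinate_ring V\<^esub> g = restrict (\<lambda>x. f x + g x) V"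
    "\<And>f g. f \<otimes>\<^bsub>coordinate_ring V\<^esub> g = restrict (\<lambda>x. f x * g x) V"
    "\<zero>\<^bsub>coordinate_ring V\<^esub> = restrict (\<lambda>x. 0) V" "\<one>\<^bsub>coordinate_ring V\<^esub> = restrict (\<lambda>x. 1) V"
    by (simp_all add: coordinate_ring_def)
  show ?thesis
  proof (intro cringI abelian_groupI comm_monoidI)
    fix f assume "f \<in> carrier (coordinate_ring V)"
    then show "\<exists>y\<in>carrier (coordinate_ring V).
        y \<oplus>\<^bsub>coordinate_ring V\<^esub> f = \<zero>\<^bsub>coordinate_ring V\<^esub>"
      using inv by (simp add: ops)
  qed (auto simp: ops closed cst fun_eq_iff restrict_def algebra_simps ext
        intro: closed[unfolded restrict_def] cst[unfolded restrict_def])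
qed

end

theory Submission
  imports Defs
begin

text \<open>
  Take for \<open>S\<close> the permutation matrix of the transposition of two indices \<open>a\<close> and \<open>b\<close>. The fibre
  over \<open>(0, S)\<close> contains the points \<open>(U D\<^sub>r, D\<^sub>r S U*)\<close> with \<open>U\<close> unitary and \<open>D\<^sub>r\<close> diagonal with
  entries \<open>r\<close> at \<open>a\<close>, \<open>1/r\<close> at \<open>b\<close> and \<open>1\<close> elsewhere: besides the \<open>n\<^sup>2\<close> parameters of \<open>U\<close> there is
  the extra parameter \<open>r > 0\<close>. The Cayley transform makes all \<open>n\<^sup>2 + 1\<close> parameters rational.
  Polynomial functions vanishing on a set in which any two points are joined by a rational curve
  form a prime ideal, since the numerators of their restrictions to such a curve lie in the domain
  \<open>\<real>[t]\<close>. Freeing the parameters one at a time, with \<open>r\<close> last, gives a chain of such sets. While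
  \<open>r = 1\<close>, the parameters of \<open>U\<close> are rational functions of the point, and \<open>r\<^sup>2\<close> is an entry of
  \<open>A*A\<close>; so the ideals are distinct and form a chain of length \<open>n\<^sup>2 + 1\<close>.
\<close>

section \<open>Algebras of real functions\<close>

text \<open>Polynomial functions of a matrix pair and rational functions of a curve parameter share
  these closure properties, so determinants and matrix products are treated once for both.\<close>

locale function_algebra =
  fixes P :: "('a \<Rightarrow> real) \<Rightarrow> bool"
  assumes const: "P (\<lambda>x. c)"
    and add: "P f \<Longrightarrow> P g \<Longrightarrow> P (\<lambda>x. f x + g x)"
    and mult: "P f \<Longrightarrow> P g \<Longrightarrow> P (\<lambda>x. f x * g x)"
begin

text \<open>Matrix entries are complex while the coordinate ring is real; complex functions are
  therefore tracked through their real and imaginary parts.\<close>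

definition complexified :: "('a \<Rightarrow> complex) \<Rightarrow> bool" where
  "complexified h \<longleftrightarrow> P (\<lambda>x. Re (h x)) \<and> P (\<lambda>x. Im (h x))"

lemma minus: "P f \<Longrightarrow> P (\<lambda>x. - f x)"
  using mult[OF const[of "-1"], of f] by simp

lemma diff: "P f \<Longrightarrow> P g \<Longrightarrow> P (\<lambda>x. f x - g x)"
  using add[OF _ minus, of f g] by simp

lemma sum: "(\<And>i. i \<in> I \<Longrightarrow> P (f i)) \<Longrightarrow> P (\<lambda>x. \<Sum>i\<in>I. f i x)"
  by (induction I rule: infinite_finite_induct) (auto intro: const add)

lemma cond: "P f \<Longrightarrow> P g \<Longrightarrow> P (\<lambda>x. if c then f x else g x)"
  by (cases c) simp_all

lemma complexified_cond:
  "complexified f \<Longrightarrow> complexified g \<Longrightarrow> complexified (\<lambda>x. if c then f x else g x)"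
  by (cases c) simp_all

lemma complexified_const: "complexified (\<lambda>x. c)"
  by (simp add: complexified_def const)

lemma complexified_of_real: "P f \<Longrightarrow> complexified (\<lambda>x. complex_of_real (f x))"
  by (simp add: complexified_def const)

lemma complexified_cnj: "complexified f \<Longrightarrow> complexified (\<lambda>x. cnj (f x))"
  by (simp add: complexified_def minus)

lemma complexified_add:
  "complexified f \<Longrightarrow> complexified g \<Longrightarrow> complexified (\<lambda>x. f x + g x)"
  by (simp add: complexified_def add)

lemma complexified_diff:
  "complexified f \<Longrightarrow> complexified g \<Longrightarrow> complexified (\<lambda>x. f x - g x)"
  by (simp add: complexified_def diff)

lemma complexified_mult:
  "complexified f \<Longrightarrow> complexified g \<Longrightarrow> complexified (\<lambda>x. f x * g x)"
  by (simp add: complexified_def add diff mult)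

lemma complexified_sum:
  "(\<And>i. i \<in> I \<Longrightarrow> complexified (f i)) \<Longrightarrow> complexified (\<lambda>x. \<Sum>i\<in>I. f i x)"
  by (induction I rule: infinite_finite_induct) (auto intro: complexified_const complexified_add)

lemma complexified_prod:
  "(\<And>i. i \<in> I \<Longrightarrow> complexified (f i)) \<Longrightarrow> complexified (\<lambda>x. \<Prod>i\<in>I. f i x)"
  by (induction I rule: infinite_finite_induct) (auto intro: complexified_const complexified_mult)

lemma complexified_det:
  fixes M :: "'a \<Rightarrow> complex^'n^'n"
  assumes "\<And>i j. complexified (\<lambda>x. M x $ i $ j)"
  shows "complexified (\<lambda>x. det (M x))"
  unfolding det_def
  by (intro complexified_sum complexified_mult complexified_const complexified_prod assms)

lemma complexified_matrix_mult:
  fixes M :: "'a \<Rightarrow> complex^'n^'m" and N :: "'a \<Rightarrow> complex^'k^'n"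
  assumes "\<And>i j. complexified (\<lambda>x. M x $ i $ j)" "\<And>i j. complexified (\<lambda>x. N x $ i $ j)"
  shows "complexified (\<lambda>x. (M x ** N x) $ i $ j)"
  unfolding matrix_matrix_mult_def
  by (simp add: complexified_sum complexified_mult assms)

lemma complexified_conj_transpose:
  assumes "\<And>i j. complexified (\<lambda>x. M x $ i $ j)"
  shows "complexified (\<lambda>x. conj_transpose (M x) $ i $ j)"
  unfolding conj_transpose_def transpose_def by (simp add: complexified_cnj assms)

end

section \<open>Polynomial functions, and rational functions without poles on the unit
  interval\<close>

interpretation poly_fun: function_algebra "real_polynomial_function :: ('a::real_normed_vector \<Rightarrow> real) \<Rightarrow> bool"
  by standard auto

text \<open>The quotient has no pole on the closed interval. Values outside are unconstrained, since
  curves are followed only from 0 to 1.\<close>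

definition rational_on_unit :: "(real \<Rightarrow> real) \<Rightarrow> bool" where
  "rational_on_unit h \<longleftrightarrow>
     (\<exists>p q. \<forall>t\<in>{0..1}. poly q t \<noteq> 0 \<and> h t = poly p t / poly q t)"

interpretation rat_fun: function_algebra rational_on_unit
proof
  show "rational_on_unit (\<lambda>x. c)" for c
    unfolding rational_on_unit_def by (intro exI[of _ "[:c:]"] exI[of _ 1]) simp
next
  fix f g assume "rational_on_unit f" "rational_on_unit g"
  then obtain p q p' q' where
    "\<forall>t\<in>{0..1}. poly q t \<noteq> 0 \<and> f t = poly p t / poly q t"
    "\<forall>t\<in>{0..1}. poly q' t \<noteq> 0 \<and> g t = poly p' t / poly q' t"
    unfolding rational_on_unit_def by blast
  then have "\<forall>t\<in>{0..1}. poly (q * q') t \<noteq> 0 \<and> f t + g t = poly (p * q' + p' * q) t / poly (q * q') t"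
    "\<forall>t\<in>{0..1}. poly (q * q') t \<noteq> 0 \<and> f t * g t = poly (p * p') t / poly (q * q') t"
    by (auto simp: field_simps)
  then show "rational_on_unit (\<lambda>x. f x + g x)" "rational_on_unit (\<lambda>x. f x * g x)"
    unfolding rational_on_unit_def by blast+
qed

lemma rational_on_unit_affine: "rational_on_unit (\<lambda>t. (1 - t) * u + t * v)"
  unfolding rational_on_unit_def
  by (intro exI[of _ "[:u, v - u:]"] exI[of _ 1]) (simp add: algebra_simps)

lemma rational_on_unit_inverse:
  assumes "rational_on_unit f" "\<And>t. t \<in> {0..1} \<Longrightarrow> f t \<noteq> 0"
  shows "rational_on_unit (\<lambda>t. 1 / f t)"
proof -
  obtain p q where "\<forall>t\<in>{0..1}. poly q t \<noteq> 0 \<and> f t = poly p t / poly q t"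
    using assms(1) unfolding rational_on_unit_def by blast
  then have "\<forall>t\<in>{0..1}. poly p t \<noteq> 0 \<and> 1 / f t = poly q t / poly p t"
    using assms(2) by auto
  then show ?thesis
    unfolding rational_on_unit_def by blast
qed

text \<open>Expanding by \<open>cnj (g t)\<close> makes the denominator the real function
  \<open>|g t|^2\<close>, which has no zero on the interval.\<close>

lemma complex_rational_divide:
  assumes f: "rat_fun.complexified f" and g: "rat_fun.complexified g"
    and nz: "\<And>t. t \<in> {0..1} \<Longrightarrow> g t \<noteq> 0"
  shows "rat_fun.complexified (\<lambda>t. f t / g t)"
proof -
  have "rational_on_unit (\<lambda>t. 1 / ((Re (g t))\<^sup>2 + (Im (g t))\<^sup>2))"
    using g nz unfolding power2_eq_square rat_fun.complexified_def
    by (intro rational_on_unit_inverse rat_fun.add rat_fun.mult)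
      (auto simp: complex_eq_iff simp flip: power2_eq_square)
  then have "rat_fun.complexified
      (\<lambda>t. f t * cnj (g t) * complex_of_real (1 / ((Re (g t))\<^sup>2 + (Im (g t))\<^sup>2)))"
    by (intro rat_fun.complexified_mult rat_fun.complexified_cnj rat_fun.complexified_of_real f g)
  moreover have "f t * cnj (g t) * complex_of_real (1 / ((Re (g t))\<^sup>2 + (Im (g t))\<^sup>2)) = f t / g t" for t
    by (simp add: complex_div_cnj[of "f t" "g t"] cmod_power2)
  ultimately show ?thesis by simp
qed

text \<open>The product of the numerators vanishes at infinitely many points, hence is the zero
  polynomial, and real polynomials form a domain.\<close>

lemma rational_on_unit_mult_zero:
  assumes "rational_on_unit f" "rational_on_unit g"
    and "\<And>t. t \<in> {0..1} \<Longrightarrow> f t * g t = 0"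
  shows "(\<forall>t\<in>{0..1}. f t = 0) \<or> (\<forall>t\<in>{0..1}. g t = 0)"
proof -
  obtain p q p' q' where
    pq: "\<forall>t\<in>{0..1}. poly q t \<noteq> 0 \<and> f t = poly p t / poly q t"
      "\<forall>t\<in>{0..1}. poly q' t \<noteq> 0 \<and> g t = poly p' t / poly q' t"
    using assms(1,2) unfolding rational_on_unit_def by blast
  have "{0..1} \<subseteq> {t. poly (p * p') t = 0}"
    using pq assms(3) by fastforce
  moreover have "infinite {0..1::real}"
    by (simp add: infinite_Icc)
  ultimately have "p * p' = 0"
    using poly_roots_finite finite_subset by blast
  then show ?thesis
    using pq by auto
qed

section \<open>Prime ideals from rationally connected sets\<close>

definition rational_curve :: "(real \<Rightarrow> 'a::euclidean_space) \<Rightarrow> bool" where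
  "rational_curve c \<longleftrightarrow> (\<forall>b\<in>Basis. rational_on_unit (\<lambda>t. c t \<bullet> b))"

lemma rational_on_unit_poly_curve:
  assumes "real_polynomial_function f" "rational_curve c"
  shows "rational_on_unit (\<lambda>t. f (c t))"
  using assms(1)
proof (induction rule: real_polynomial_function.induct)
  case (linear f)
  have "f (c t) = (\<Sum>b\<in>Basis. (c t \<bullet> b) * f b)" for t
  proof -
    have "f (\<Sum>b\<in>Basis. (c t \<bullet> b) *\<^sub>R b) = (\<Sum>b\<in>Basis. (c t \<bullet> b) * f b)"
      using linear by (simp add: bounded_linear.linear linear_sum linear_scale)
    then show ?thesis
      by (simp add: euclidean_representation)
  qed
  then show ?case
    using assms(2) by (simp add: rational_curve_def rat_fun.sum rat_fun.mult rat_fun.const)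
qed (auto intro: rat_fun.const rat_fun.add rat_fun.mult)

definition rationally_connected :: "'a::euclidean_space set \<Rightarrow> bool" where
  "rationally_connected Z \<longleftrightarrow>
     (\<forall>x\<in>Z. \<forall>y\<in>Z. \<exists>c. rational_curve c \<and> c 0 = x \<and> c 1 = y \<and> c ` {0..1} \<subseteq> Z)"

definition vanishing_ideal :: "'a::real_normed_vector set \<Rightarrow> 'a set \<Rightarrow> ('a \<Rightarrow> real) set" where
  "vanishing_ideal V Z = {f \<in> carrier (coordinate_ring V). \<forall>z\<in>Z. f z = 0}"

lemma coordinate_ring_eval:
  assumes "z \<in> V"
  shows "(f \<oplus>\<^bsub>coordinate_ring V\<^esub> g) z = f z + g z"
    and "(f \<otimes>\<^bsub>coordinate_ring V\<^esub> g) z = f z * g z"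
    and "\<zero>\<^bsub>coordinate_ring V\<^esub> z = 0"
    and "\<one>\<^bsub>coordinate_ring V\<^esub> z = 1"
  using assms by (simp_all add: coordinate_ring_def)

lemma ideal_vanishing_ideal:
  assumes "Z \<subseteq> V"
  shows "ideal (vanishing_ideal V Z) (coordinate_ring V)"
proof -
  interpret R: cring "coordinate_ring V"
    by (rule cring_coordinate_ring)
  have ZV: "z \<in> V" if "z \<in> Z" for z
    using that assms by blast
  \<comment> \<open>The additive inverse is given abstractly by the ring structure; its values are
    found by evaluating \<open>f\<close> plus its inverse at \<open>z\<close>.\<close>
  have neg: "(\<ominus>\<^bsub>coordinate_ring V\<^esub> f) z = - f z"
    if f: "f \<in> carrier (coordinate_ring V)" and z: "z \<in> V" for f z
  proof -
    have "(f \<oplus>\<^bsub>coordinate_ring V\<^esub> \<ominus>\<^bsub>coordinate_ring V\<^esub> f) z = \<zero>\<^bsub>coordinate_ring V\<^esub> z"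
      by (simp only: R.r_neg[OF f])
    then show ?thesis
      by (simp add: coordinate_ring_eval[OF z])
  qed
  have "subgroup (vanishing_ideal V Z) (add_monoid (coordinate_ring V))"
  proof (rule subgroup.intro)
    show "vanishing_ideal V Z \<subseteq> carrier (add_monoid (coordinate_ring V))"
      by (auto simp: vanishing_ideal_def)
    show "\<one>\<^bsub>add_monoid (coordinate_ring V)\<^esub> \<in> vanishing_ideal V Z"
      by (simp add: vanishing_ideal_def coordinate_ring_eval ZV)
    show "f \<otimes>\<^bsub>add_monoid (coordinate_ring V)\<^esub> g \<in> vanishing_ideal V Z"
      if "f \<in> vanishing_ideal V Z" "g \<in> vanishing_ideal V Z" for f g
      using that by (simp add: vanishing_ideal_def coordinate_ring_eval ZV)
    show "inv\<^bsub>add_monoid (coordinate_ring V)\<^esub> f \<in> vanishing_ideal V Z"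
      if "f \<in> vanishing_ideal V Z" for f
      using that unfolding a_inv_def[symmetric] by (simp add: vanishing_ideal_def neg ZV)
  qed
  then show ?thesis
    by (intro idealI R.ring_axioms) (simp_all add: vanishing_ideal_def coordinate_ring_eval ZV)
qed

text \<open>If neither factor vanishes on \<open>Z\<close>, join a point where the first is nonzero
  to a point where the second is nonzero. Along the curve the product is zero, so one factor
  vanishes on all of it, against its value at an endpoint.\<close>

lemma primeideal_vanishing_ideal:
  assumes sub: "Z \<subseteq> V" and ne: "Z \<noteq> {}" and conn: "rationally_connected Z"
  shows "primeideal (vanishing_ideal V Z) (coordinate_ring V)"
proof (rule primeidealI)
  show "ideal (vanishing_ideal V Z) (coordinate_ring V)"
    by (rule ideal_vanishing_ideal[OF sub])
  show "cring (coordinate_ring V)"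
    by (rule cring_coordinate_ring)
  then interpret R: cring "coordinate_ring V" .
  obtain z where "z \<in> Z" "z \<in> V"
    using ne sub by blast
  then have "\<one>\<^bsub>coordinate_ring V\<^esub> \<notin> vanishing_ideal V Z"
    using coordinate_ring_eval(4)[of z V] by (force simp: vanishing_ideal_def)
  moreover have "\<one>\<^bsub>coordinate_ring V\<^esub> \<in> carrier (coordinate_ring V)"
    by simp
  ultimately show "carrier (coordinate_ring V) \<noteq> vanishing_ideal V Z"
    by blast
next
  fix f g
  assume f: "f \<in> carrier (coordinate_ring V)" and g: "g \<in> carrier (coordinate_ring V)"
    and fg: "f \<otimes>\<^bsub>coordinate_ring V\<^esub> g \<in> vanishing_ideal V Z"
  obtain p q where p: "real_polynomial_function p" "f = restrict p V"
    and q: "real_polynomial_function q" "g = restrict q V"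
    using f g by (auto simp: coordinate_ring_def)
  have pq: "p z * q z = 0" if "z \<in> Z" for z
  proof -
    have "(f \<otimes>\<^bsub>coordinate_ring V\<^esub> g) z = 0" "z \<in> V"
      using fg that sub by (auto simp: vanishing_ideal_def)
    then show ?thesis
      using p(2) q(2) by (simp add: coordinate_ring_eval)
  qed
  show "f \<in> vanishing_ideal V Z \<or> g \<in> vanishing_ideal V Z"
  proof (rule ccontr)
    assume "\<not> ?thesis"
    then obtain x y where x: "x \<in> Z" "p x \<noteq> 0" and y: "y \<in> Z" "q y \<noteq> 0"
      using f g sub by (auto simp: vanishing_ideal_def p(2) q(2) subset_iff)
    then obtain c where c: "rational_curve c" "c 0 = x" "c 1 = y" "c ` {0..1} \<subseteq> Z"
      using conn unfolding rationally_connected_def by blast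
    have "(\<forall>t\<in>{0..1}. p (c t) = 0) \<or> (\<forall>t\<in>{0..1}. q (c t) = 0)"
      using rational_on_unit_mult_zero[OF rational_on_unit_poly_curve[OF p(1) c(1)]
          rational_on_unit_poly_curve[OF q(1) c(1)]] pq c(4) by blast
    then show False
      using x(2) y(2) unfolding c(2,3)[symmetric] by (meson atLeastAtMost_iff order_refl zero_le_one)
  qed
qed

section \<open>Lower bounds for the dimension from chains of sets\<close>

lemma krull_dim_ge:
  assumes "\<And>k. k \<le> d \<Longrightarrow> primeideal (P k) R" "\<And>k. k < d \<Longrightarrow> P k \<subset> P (Suc k)"
  shows "ereal (real d) \<le> krull_dim R"
  unfolding krull_dim_def using assms by (intro Sup_upper) blast

text \<open>Larger sets have smaller vanishing ideals, so the chain of sets read backwards gives an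
  ascending chain of primes; the separating polynomials make it strict.\<close>

lemma real_algebraic_dim_ge:
  fixes V :: "'a::euclidean_space set"
  assumes sub: "\<And>k. k \<le> d \<Longrightarrow> Z k \<subseteq> V"
    and ne: "\<And>k. k \<le> d \<Longrightarrow> Z k \<noteq> {}"
    and conn: "\<And>k. k \<le> d \<Longrightarrow> rationally_connected (Z k)"
    and mono: "\<And>k. k < d \<Longrightarrow> Z k \<subseteq> Z (Suc k)"
    and sep: "\<And>k. k < d \<Longrightarrow>
      \<exists>f. real_polynomial_function f \<and> (\<forall>z\<in>Z k. f z = 0) \<and> (\<exists>z\<in>Z (Suc k). f z \<noteq> 0)"
  shows "ereal (real d) \<le> real_algebraic_dim V"
  unfolding real_algebraic_dim_def
proof (rule krull_dim_ge)
  fix k assume "k \<le> d"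
  then show "primeideal (vanishing_ideal V (Z (d - k))) (coordinate_ring V)"
    by (intro primeideal_vanishing_ideal sub ne conn) auto
next
  fix k assume k: "k < d"
  \<comment> \<open>Because of the reversal, the ideals numbered \<open>k\<close> and
    \<open>Suc k\<close> are those of \<open>Z (Suc m)\<close> and \<open>Z m\<close>.\<close>
  define m where "m = d - Suc k"
  have m: "m < d" "d - k = Suc m" "d - Suc k = m"
    using k by (auto simp: m_def)
  obtain f where f: "real_polynomial_function f" "\<forall>z\<in>Z m. f z = 0" "\<exists>z\<in>Z (Suc m). f z \<noteq> 0"
    using sep[OF m(1)] by blast
  have "restrict f V \<in> vanishing_ideal V (Z m)"
    using f(1,2) sub[of m] m(1) by (auto simp: vanishing_ideal_def coordinate_ring_def subset_iff)
  moreover have "restrict f V \<notin> vanishing_ideal V (Z (Suc m))"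
    using f(3) sub[of "Suc m"] m(1) by (auto simp: vanishing_ideal_def subset_iff)
  moreover have "vanishing_ideal V (Z (Suc m)) \<subseteq> vanishing_ideal V (Z m)"
    using mono[OF m(1)] by (auto simp: vanishing_ideal_def)
  ultimately show "vanishing_ideal V (Z (d - k)) \<subset> vanishing_ideal V (Z (d - Suc k))"
    unfolding m by blast
qed

section \<open>The Cayley transform\<close>

lemma conj_transpose_nth [simp]: "conj_transpose A $ i $ j = cnj (A $ j $ i)"
  by (simp add: conj_transpose_def transpose_def)

lemma conj_transpose_matrix_mult: "conj_transpose (A ** B) = conj_transpose B ** conj_transpose A"
  by (simp add: vec_eq_iff matrix_matrix_mult_def mult.commute)

lemma conj_transpose_mat_1 [simp]: "conj_transpose (mat 1) = mat 1"
  by (auto simp: vec_eq_iff mat_def)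

lemma conj_transpose_conj_transpose [simp]: "conj_transpose (conj_transpose A) = A"
  by (simp add: vec_eq_iff)

lemma conj_transpose_0 [simp]: "conj_transpose 0 = 0"
  by (simp add: vec_eq_iff)

lemma conj_transpose_add: "conj_transpose (A + B) = conj_transpose A + conj_transpose B"
  by (simp add: vec_eq_iff)

lemma conj_transpose_diff: "conj_transpose (A - B) = conj_transpose A - conj_transpose B"
  by (simp add: vec_eq_iff)

lemma conj_transpose_scaleR: "conj_transpose (r *\<^sub>R A) = r *\<^sub>R conj_transpose A"
  by (simp add: vec_eq_iff)

lemma bounded_linear_conj_transpose: "bounded_linear conj_transpose"
  by (simp add: linear_conv_bounded_linear[symmetric] linear_iff conj_transpose_add conj_transpose_scaleR)

lemma bounded_bilinear_complex_matrix_mult: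
  "bounded_bilinear ((**) :: complex^'n^'m \<Rightarrow> complex^'k^'n \<Rightarrow> complex^'k^'m)"
  unfolding bilinear_conv_bounded_bilinear[symmetric] bilinear_def linear_iff
  by (simp add: vec_eq_iff matrix_matrix_mult_def distrib_left distrib_right sum.distrib scaleR_sum_right)

interpretation matmul: bounded_bilinear
  "(**) :: complex^'n^'n \<Rightarrow> complex^'n^'n \<Rightarrow> complex^'n^'n"
  by (rule bounded_bilinear_complex_matrix_mult)

text \<open>The diagonal entries of \<open>M* M\<close> are the squared norms of the columns of
  \<open>M\<close>.\<close>

lemma conj_transpose_mult_self_eq_0:
  assumes "conj_transpose M ** M = 0"
  shows "M = 0"
proof -
  have "M $ i $ j = 0" for i j
  proof -
    have "(\<Sum>k\<in>UNIV. cnj (M $ k $ j) * M $ k $ j) = 0"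
      using arg_cong[OF assms, of "\<lambda>N. N $ j $ j"] by (simp add: matrix_matrix_mult_def)
    moreover have "cnj z * z = complex_of_real ((cmod z)\<^sup>2)" for z
      by (simp only: complex_norm_square mult.commute)
    ultimately have "complex_of_real (\<Sum>k\<in>UNIV. (cmod (M $ k $ j))\<^sup>2) = 0"
      by (simp only: of_real_sum)
    then have "(\<Sum>k\<in>UNIV. (cmod (M $ k $ j))\<^sup>2) = 0"
      by (simp only: of_real_eq_0_iff)
    then show ?thesis
      by (simp add: sum_nonneg_eq_0_iff)
  qed
  then show ?thesis
    by (simp add: vec_eq_iff)
qed

text \<open>The Hermitian part of \<open>P\<close> is the identity: if \<open>P x = 0\<close>, then
  \<open>2 x* x = x* P x + (P x)* x = 0\<close>.\<close>

lemma invertible_of_add_conj_transpose: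
  fixes P :: "complex^'n^'n"
  assumes "P + conj_transpose P = 2 *\<^sub>R mat 1"
  shows "invertible P"
  unfolding invertible_left_inverse matrix_left_invertible_ker
proof (intro allI impI)
  fix x assume x: "P *v x = 0"
  \<comment> \<open>Repeating \<open>x\<close> in every column turns the kernel vector into a square
    matrix, to which the matrix identities apply.\<close>
  define M :: "complex^'n^'n" where "M = (\<chi> i j. x $ i)"
  have PM: "P ** M = 0"
    using x by (simp add: M_def vec_eq_iff matrix_matrix_mult_def matrix_vector_mult_def)
  have "2 *\<^sub>R (conj_transpose M ** M) = conj_transpose M ** (2 *\<^sub>R mat 1) ** M"
    by (simp add: matmul.scaleR_left matmul.scaleR_right)
  also have "\<dots> = conj_transpose M ** (P ** M) + conj_transpose (P ** M) ** M"
    by (simp add: assms[symmetric] matmul.add_left matmul.add_right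
        matrix_mul_assoc conj_transpose_matrix_mult)
  finally have "M = 0"
    using PM conj_transpose_mult_self_eq_0[of M]
    by (simp add: matmul.zero_left matmul.zero_right)
  then show "x = 0"
    by (simp add: M_def vec_eq_iff)
qed

text \<open>A basis-free chart of the skew-Hermitian matrices: real matrices correspond to them under
  \<open>Y \<mapsto> ((Y - Y\<^sup>T) + \<i>(Y + Y\<^sup>T)) / 2\<close>, and the entry \<open>Y i j\<close> is recovered as
  the sum of the real and imaginary parts of the image.\<close>

definition skew :: "real^'n^'n \<Rightarrow> complex^'n^'n" where
  "skew Y = (\<chi> i j. Complex ((Y $ i $ j - Y $ j $ i) / 2) ((Y $ i $ j + Y $ j $ i) / 2))"

lemma conj_transpose_skew: "conj_transpose (skew Y) = - skew Y"
  by (simp add: vec_eq_iff skew_def complex_eq_iff field_simps)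

lemma skew_recover: "Re (skew Y $ i $ j) + Im (skew Y $ i $ j) = Y $ i $ j"
  by (simp add: skew_def field_simps)

lemma one_plus_skew_add_conj_transpose:
  "(mat 1 + skew Y) + conj_transpose (mat 1 + skew Y) = 2 *\<^sub>R mat 1"
  by (simp add: conj_transpose_add conj_transpose_skew scaleR_2)

lemma invertible_one_plus_skew: "invertible (mat 1 + skew Y)"
  by (rule invertible_of_add_conj_transpose[OF one_plus_skew_add_conj_transpose])

text \<open>This is \<open>(1 - X)(1 + X)\<^sup>-\<^sup>1\<close> for \<open>X = skew Y\<close>.\<close>

definition cayley :: "real^'n^'n \<Rightarrow> complex^'n^'n" where
  "cayley Y = 2 *\<^sub>R matrix_inv (mat 1 + skew Y) - mat 1"

text \<open>The relation is symmetric in \<open>X = skew Y\<close> and \<open>U = cayley Y\<close>.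
  Read one way it computes \<open>U\<close> from \<open>X\<close>, read the other way it recovers
  \<open>X\<close> from \<open>U\<close>.\<close>

lemma cayley_mult:
  "(mat 1 + skew Y) ** (mat 1 + cayley Y) = 2 *\<^sub>R mat 1"
  "(mat 1 + cayley Y) ** (mat 1 + skew Y) = 2 *\<^sub>R mat 1"
proof -
  have "(mat 1 + skew Y) ** matrix_inv (mat 1 + skew Y) = mat 1 \<and>
      matrix_inv (mat 1 + skew Y) ** (mat 1 + skew Y) = mat 1"
    using invertible_one_plus_skew[of Y] unfolding invertible_def matrix_inv_def by (rule someI_ex)
  then show "(mat 1 + skew Y) ** (mat 1 + cayley Y) = 2 *\<^sub>R mat 1"
    "(mat 1 + cayley Y) ** (mat 1 + skew Y) = 2 *\<^sub>R mat 1"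
    by (simp_all add: cayley_def matmul.scaleR_left matmul.scaleR_right)
qed

text \<open>With \<open>P = 1 + X\<close> and \<open>Q = 1 + U\<close>, inserting
  \<open>P + P* = 2\<close> between \<open>Q*\<close> and \<open>Q\<close> and using
  \<open>P Q = 2\<close> gives \<open>Q* Q = Q* + Q\<close>, which says that \<open>Q - 1\<close> is
  unitary.\<close>

lemma cayley_unitary: "conj_transpose (cayley Y) ** cayley Y = mat 1"
proof -
  define P Q where "P = mat 1 + skew Y" and "Q = mat 1 + cayley Y"
  have PQ: "P ** Q = 2 *\<^sub>R mat 1"
    using cayley_mult[of Y] by (simp add: P_def Q_def)
  have QP: "conj_transpose Q ** conj_transpose P = 2 *\<^sub>R mat 1"
    using arg_cong[OF PQ, of conj_transpose]
    by (simp add: conj_transpose_matrix_mult conj_transpose_scaleR)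
  have "2 *\<^sub>R (conj_transpose Q ** Q) = conj_transpose Q ** (2 *\<^sub>R mat 1) ** Q"
    by (simp add: matmul.scaleR_left matmul.scaleR_right)
  also have "\<dots> = conj_transpose Q ** (P ** Q) + (conj_transpose Q ** conj_transpose P) ** Q"
    by (simp add: one_plus_skew_add_conj_transpose[of Y, folded P_def, symmetric]
        matmul.add_left matmul.add_right matrix_mul_assoc)
  also have "\<dots> = 2 *\<^sub>R (conj_transpose Q + Q)"
    by (simp add: PQ QP matmul.scaleR_left matmul.scaleR_right scaleR_add_right)
  finally have *: "conj_transpose Q ** Q = conj_transpose Q + Q"
    by simp
  have "cayley Y = Q - mat 1"
    by (simp add: Q_def)
  then have "conj_transpose (cayley Y) ** cayley Y
      = conj_transpose Q ** Q - conj_transpose Q - Q + mat 1"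
    by (simp add: conj_transpose_diff matmul.diff_left matmul.diff_right)
  then show ?thesis
    by (simp add: *)
qed

section \<open>Cramer's rule and rationality of the Cayley transform\<close>

text \<open>This is the entry \<open>(i, j)\<close> of the adjugate matrix: column \<open>i\<close>
  of \<open>P\<close> is replaced by the \<open>j\<close>-th unit vector.\<close>

definition cramer_numerator :: "'a::field^'n^'n \<Rightarrow> 'n \<Rightarrow> 'n \<Rightarrow> 'a" where
  "cramer_numerator P i j = det (\<chi> k l. if l = i then mat 1 $ k $ j else P $ k $ l)"

text \<open>Cramer's rule for column \<open>j\<close> of \<open>Q / 2\<close>, which solves
  \<open>P x = e_j\<close>. The factor 2 matches \<open>cayley_mult\<close>.\<close>

lemma inverse_entry:
  fixes P :: "complex^'n^'n"
  assumes "P ** Q = 2 *\<^sub>R mat 1"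
  shows "det P \<noteq> 0" "Q $ i $ j = 2 * cramer_numerator P i j / det P"
proof -
  have inv: "P ** (inverse 2 *\<^sub>R Q) = mat 1"
    by (simp add: matmul.scaleR_right assms)
  then have "invertible P"
    unfolding invertible_def using matrix_left_right_inverse by blast
  then show nz: "det P \<noteq> 0"
    by (simp add: invertible_det_nz)
  have "P *v (\<chi> k. (inverse 2 *\<^sub>R Q) $ k $ j) = (\<chi> k. mat 1 $ k $ j)"
    unfolding inv[symmetric] by (simp add: vec_eq_iff matrix_vector_mult_def matrix_matrix_mult_def)
  then have "(\<chi> k. (inverse 2 *\<^sub>R Q) $ k $ j) $ i = cramer_numerator P i j / det P"
    unfolding cramer[OF nz] by (simp only: vec_lambda_beta cramer_numerator_def)
  then have "inverse 2 *\<^sub>R (Q $ i $ j) = cramer_numerator P i j / det P"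
    by (simp only: vec_lambda_beta vector_scaleR_component)
  then show "Q $ i $ j = 2 * cramer_numerator P i j / det P"
    by (simp add: scaleR_conv_of_real field_simps)
qed

lemma cayley_entry:
  "cayley Y $ i $ j = 2 * cramer_numerator (mat 1 + skew Y) i j / det (mat 1 + skew Y) - mat 1 $ i $ j"
  using inverse_entry(2)[OF cayley_mult(1), of Y i j] by (simp add: algebra_simps)

lemma (in function_algebra) complexified_cramer_numerator:
  fixes M :: "'a \<Rightarrow> complex^'n^'n"
  assumes "\<And>i j. complexified (\<lambda>x. M x $ i $ j)"
  shows "complexified (\<lambda>x. cramer_numerator (M x) i j)"
  unfolding cramer_numerator_def
  unfolding vec_lambda_beta
  by (intro complexified_det) (simp add: complexified_cond assms complexified_const)

text \<open>The entries of \<open>1 + X\<close> are affine in \<open>t\<close>, and its determinant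
  vanishes for no real parameter, so Cramer's rule gives quotients without poles.\<close>

lemma rational_cayley_segment:
  fixes Y Y' :: "real^'n^'n"
  shows "rat_fun.complexified (\<lambda>t. cayley ((1 - t) *\<^sub>R Y + t *\<^sub>R Y') $ i $ j)"
proof -
  define M where "M t = mat 1 + skew ((1 - t) *\<^sub>R Y + t *\<^sub>R Y')" for t
  have Y: "rational_on_unit (\<lambda>t. ((1 - t) *\<^sub>R Y + t *\<^sub>R Y') $ i $ j)" for i j
    by (simp add: rational_on_unit_affine)
  have "rational_on_unit (\<lambda>t. (((1 - t) *\<^sub>R Y + t *\<^sub>R Y') $ i $ j - ((1 - t) *\<^sub>R Y + t *\<^sub>R Y') $ j $ i) * (1 / 2))"
    "rational_on_unit (\<lambda>t. (((1 - t) *\<^sub>R Y + t *\<^sub>R Y') $ i $ j + ((1 - t) *\<^sub>R Y + t *\<^sub>R Y') $ j $ i) * (1 / 2))"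
    for i j
    by (intro rat_fun.mult rat_fun.diff rat_fun.add rat_fun.const Y)+
  then have "rat_fun.complexified (\<lambda>t. skew ((1 - t) *\<^sub>R Y + t *\<^sub>R Y') $ i $ j)" for i j
    unfolding rat_fun.complexified_def skew_def by simp
  then have M: "rat_fun.complexified (\<lambda>t. M t $ i $ j)" for i j
    unfolding M_def vector_add_component
    by (intro rat_fun.complexified_add rat_fun.complexified_const)
  have "det (M t) \<noteq> 0" for t
    using invertible_one_plus_skew by (simp add: M_def flip: invertible_det_nz)
  then show ?thesis
    unfolding cayley_entry M_def[symmetric]
    by (intro rat_fun.complexified_diff complex_rational_divide rat_fun.complexified_mult
        rat_fun.complexified_cramer_numerator rat_fun.complexified_det rat_fun.complexified_const M)
qed

lemma rational_curve_matrix_pair: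
  fixes c :: "real \<Rightarrow> (complex^'n^'m) \<times> (complex^'k^'l)"
  assumes "\<And>i j. rat_fun.complexified (\<lambda>t. fst (c t) $ i $ j)"
    and "\<And>i j. rat_fun.complexified (\<lambda>t. snd (c t) $ i $ j)"
  shows "rational_curve c"
  unfolding rational_curve_def
  using assms
  by (auto simp: Basis_prod_def Basis_vec_def Basis_complex_def inner_prod_def inner_axis
      rat_fun.complexified_def)

section \<open>The fibre over a transposition matrix\<close>

definition diagonal_scaling :: "'n \<Rightarrow> 'n \<Rightarrow> real \<Rightarrow> complex^'n^'n" where
  "diagonal_scaling a b r =
     (\<chi> i j. if i = j then complex_of_real (if i = a then r else if i = b then 1 / r else 1) else 0)"

definition swap_matrix :: "'n \<Rightarrow> 'n \<Rightarrow> complex^'n^'n" where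
  "swap_matrix a b = (\<chi> i j. if j = Transposition.transpose a b i then 1 else 0)"

lemma swap_matrix_mult_nth:
  "(swap_matrix a b ** M) $ i $ j = M $ Transposition.transpose a b i $ j"
  "(M ** swap_matrix a b) $ i $ j = M $ i $ Transposition.transpose a b j"
proof -
  show "(swap_matrix a b ** M) $ i $ j = M $ Transposition.transpose a b i $ j"
    by (simp add: swap_matrix_def matrix_matrix_mult_def if_distrib[where f="\<lambda>x. x * _"] cong: if_cong)
  have "j = Transposition.transpose a b k \<longleftrightarrow> k = Transposition.transpose a b j" for k
    by (metis transpose_involutory)
  then show "(M ** swap_matrix a b) $ i $ j = M $ i $ Transposition.transpose a b j"
    by (simp add: swap_matrix_def matrix_matrix_mult_def if_distrib[where f="\<lambda>x. _ * x"] cong: if_cong)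
qed

lemma swap_matrix_square: "swap_matrix a b ** swap_matrix a b = mat 1"
  by (simp add: vec_eq_iff swap_matrix_mult_nth)
    (auto simp: swap_matrix_def mat_def dest: injD[OF inj_transpose])

lemma conj_transpose_swap_matrix: "conj_transpose (swap_matrix a b) = swap_matrix a b"
proof -
  have "j = Transposition.transpose a b k \<longleftrightarrow> k = Transposition.transpose a b j" for k j
    by (metis transpose_involutory)
  then show ?thesis
    by (simp add: vec_eq_iff swap_matrix_def)
qed

lemma diagonal_scaling_mult_nth:
  "(diagonal_scaling a b r ** M) $ i $ j = diagonal_scaling a b r $ i $ i * M $ i $ j"
  "(M ** diagonal_scaling a b r) $ i $ j = M $ i $ j * diagonal_scaling a b r $ j $ j"
  by (simp_all add: diagonal_scaling_def matrix_matrix_mult_def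
      if_distrib[where f="\<lambda>x. x * _"] if_distrib[where f="\<lambda>x. _ * x"] cong: if_cong)

lemma conj_transpose_diagonal_scaling:
  "conj_transpose (diagonal_scaling a b r) = diagonal_scaling a b r"
  by (simp add: vec_eq_iff diagonal_scaling_def)

lemma diagonal_scaling_1: "diagonal_scaling a b 1 = mat 1"
  by (simp add: vec_eq_iff diagonal_scaling_def mat_def)

text \<open>The entry at \<open>(i, j)\<close> is multiplied by \<open>d_i d_j\<close>. Where the
  swap matrix is nonzero, either \<open>i = j\<close> lies outside \<open>{a, b}\<close> and both
  factors are 1, or they are \<open>r\<close> and \<open>1 / r\<close>.\<close>

lemma diagonal_scaling_swap:
  assumes "a \<noteq> b" "r \<noteq> 0"
  shows "diagonal_scaling a b r ** swap_matrix a b ** diagonal_scaling a b r = swap_matrix a b"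
  using assms
  by (auto simp: vec_eq_iff diagonal_scaling_mult_nth)
    (auto simp: swap_matrix_def diagonal_scaling_def Transposition.transpose_def)

text \<open>Every unitary \<open>U\<close> acts on the fibres of \<open>\<phi>\<close> by \<open>(A, B) \<mapsto> (U A, B U*)\<close>; here it is
  applied to the one-parameter family of points \<open>(D\<^sub>r, D\<^sub>r S)\<close> of the fibre over \<open>(0, S)\<close>.\<close>

definition fibre_point :: "'n \<Rightarrow> 'n \<Rightarrow> (real^'n^'n) \<times> real \<Rightarrow> (complex^'n^'n) \<times> (complex^'n^'n)" where
  "fibre_point a b = (\<lambda>(Y, r).
     (cayley Y ** diagonal_scaling a b r,
      diagonal_scaling a b r ** swap_matrix a b ** conj_transpose (cayley Y)))"

text \<open>Unitarity cancels \<open>U\<close> everywhere: \<open>A* A\<close> and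
  \<open>B B*\<close> both become \<open>D D\<close>, and \<open>B A\<close> becomes
  \<open>D S D = S\<close>.\<close>

lemma phi_fibre_point:
  assumes "a \<noteq> b" "r \<noteq> 0"
  shows "phi (fibre_point a b (Y, r)) = (0, swap_matrix a b)"
proof -
  let ?U = "cayley Y" and ?D = "diagonal_scaling a b r" and ?S = "swap_matrix a b"
  have cancel: "M ** conj_transpose ?U ** ?U = M" "M ** ?S ** ?S = M" for M
    using cayley_unitary[of Y] swap_matrix_square[of a b]
    by (simp_all flip: matrix_mul_assoc)
  have "conj_transpose (?U ** ?D) ** (?U ** ?D) = ?D ** ?D"
    by (simp add: conj_transpose_matrix_mult conj_transpose_diagonal_scaling matrix_mul_assoc cancel)
  moreover have "(?D ** ?S ** conj_transpose ?U) ** conj_transpose (?D ** ?S ** conj_transpose ?U) = ?D ** ?D"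
    by (simp add: conj_transpose_matrix_mult conj_transpose_diagonal_scaling
        conj_transpose_swap_matrix matrix_mul_assoc cancel)
  moreover have "(?D ** ?S ** conj_transpose ?U) ** (?U ** ?D) = ?S"
    by (simp add: matrix_mul_assoc cancel diagonal_scaling_swap assms)
  ultimately show ?thesis
    by (simp add: phi_def fibre_point_def vec_eq_iff)
qed

text \<open>By convexity the segment between two parameters stays in \<open>T\<close>. Its image is
  a rational curve; \<open>r > 0\<close> along it keeps the entry \<open>1 / r\<close> free of
  poles.\<close>

lemma rationally_connected_fibre_points:
  assumes conv: "convex T" and pos: "\<And>Y r. (Y, r) \<in> T \<Longrightarrow> r > 0"
  shows "rationally_connected (fibre_point a b ` T)"
  unfolding rationally_connected_def
proof (intro ballI)
  fix x y assume "x \<in> fibre_point a b ` T" "y \<in> fibre_point a b ` T"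
  then obtain Y r Y' r' where
    x: "(Y, r) \<in> T" "x = fibre_point a b (Y, r)" and y: "(Y', r') \<in> T" "y = fibre_point a b (Y', r')"
    by auto
  define Yt where "Yt t = (1 - t) *\<^sub>R Y + t *\<^sub>R Y'" for t
  define rt where "rt t = (1 - t) * r + t * r'" for t
  have T: "(Yt t, rt t) \<in> T" if "t \<in> {0..1}" for t
    using convexD[OF conv x(1) y(1), of "1 - t" t] that by (simp add: Yt_def rt_def)
  have r: "rational_on_unit rt"
    unfolding rt_def by (rule rational_on_unit_affine)
  have "rt t \<noteq> 0" if "t \<in> {0..1}" for t
    using pos[OF T[OF that]] by simp
  then have "rational_on_unit (\<lambda>t. 1 / rt t)"
    by (rule rational_on_unit_inverse[OF r])
  then have D: "rat_fun.complexified (\<lambda>t. diagonal_scaling a b (rt t) $ i $ j)" for i j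
    using r unfolding diagonal_scaling_def vec_lambda_beta
    by (intro rat_fun.complexified_cond rat_fun.complexified_of_real rat_fun.complexified_const
        rat_fun.cond rat_fun.const)
  have U: "rat_fun.complexified (\<lambda>t. cayley (Yt t) $ i $ j)" for i j
    unfolding Yt_def by (rule rational_cayley_segment)
  have "rational_curve (\<lambda>t. fibre_point a b (Yt t, rt t))"
  proof (rule rational_curve_matrix_pair)
    show "rat_fun.complexified (\<lambda>t. fst (fibre_point a b (Yt t, rt t)) $ i $ j)" for i j
      unfolding fibre_point_def prod.case fst_conv
      by (intro rat_fun.complexified_matrix_mult U D)
    show "rat_fun.complexified (\<lambda>t. snd (fibre_point a b (Yt t, rt t)) $ i $ j)" for i j
      unfolding fibre_point_def prod.case snd_conv
      by (intro rat_fun.complexified_matrix_mult rat_fun.complexified_conj_transpose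
          rat_fun.complexified_const U D)
  qed
  then show "\<exists>c. rational_curve c \<and> c 0 = x \<and> c 1 = y \<and> c ` {0..1} \<subseteq> fibre_point a b ` T"
    using T x(2) y(2)
    by (intro exI[of _ "\<lambda>t. fibre_point a b (Yt t, rt t)"]) (auto simp: Yt_def rt_def)
qed

section \<open>Separating polynomials and the dimension of the fibre\<close>

lemma complexified_polynomial_entry:
  fixes c :: "'a::real_normed_vector \<Rightarrow> complex^'n^'m"
  assumes "bounded_linear c"
  shows "poly_fun.complexified (\<lambda>x. c x $ i $ j)"
  unfolding poly_fun.complexified_def
  by (intro conjI real_polynomial_function.intros(1) bounded_linear_compose[OF bounded_linear_Re]
      bounded_linear_compose[OF bounded_linear_Im] bounded_linear_compose[OF bounded_linear_vec_nth]
      assms)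

text \<open>Since \<open>1 + X = 2 (1 + U)\<^sup>-\<^sup>1\<close> for the Cayley transform \<open>U\<close> of \<open>X = skew Y\<close>, the coordinate
  \<open>Y i j\<close> times \<open>\<bar>det (1 + U)\<bar>\<^sup>2\<close> is a real polynomial in \<open>U\<close>.\<close>

lemma polynomial_cayley_coordinate:
  fixes i j :: "'n::finite"
  obtains f :: "(complex^'n^'n) \<times> (complex^'n^'n) \<Rightarrow> real"
  where "real_polynomial_function f"
    and "\<And>Y B. f (cayley Y, B) = 0 \<longleftrightarrow> Y $ i $ j = 0"
proof -
  \<comment> \<open>Clearing the denominator and multiplying by the conjugate determinant leaves a
    real factor, so that real and imaginary parts can still be added to recover
    \<open>Y\<close>.\<close>
  define h :: "(complex^'n^'n) \<times> (complex^'n^'n) \<Rightarrow> complex" where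
    "h p = cnj (det (mat 1 + fst p)) * (2 * cramer_numerator (mat 1 + fst p) i j
       - det (mat 1 + fst p) * mat 1 $ i $ j)" for p
  have "poly_fun.complexified (\<lambda>p :: (complex^'n^'n) \<times> (complex^'n^'n). fst p $ k $ l)" for k l
    by (rule complexified_polynomial_entry[OF bounded_linear_fst])
  then have M: "poly_fun.complexified
      (\<lambda>p :: (complex^'n^'n) \<times> (complex^'n^'n). (mat 1 + fst p) $ k $ l)" for k l
    unfolding vector_add_component
    by (intro poly_fun.complexified_add poly_fun.complexified_const)
  have "poly_fun.complexified h"
    unfolding h_def
    by (intro poly_fun.complexified_mult poly_fun.complexified_diff poly_fun.complexified_cnj
        poly_fun.complexified_const poly_fun.complexified_det poly_fun.complexified_cramer_numerator M)
  then have f: "real_polynomial_function (\<lambda>p. Re (h p) + Im (h p))"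
    unfolding poly_fun.complexified_def by auto
  have "Re (h (cayley Y, B)) + Im (h (cayley Y, B)) = (cmod (det (mat 1 + cayley Y)))\<^sup>2 * Y $ i $ j"
    and "det (mat 1 + cayley Y) \<noteq> 0" for Y B
  proof -
    let ?d = "det (mat 1 + cayley Y)"
    show nz: "?d \<noteq> 0"
      by (rule inverse_entry(1)[OF cayley_mult(2)])
    have X: "skew Y $ i $ j = 2 * cramer_numerator (mat 1 + cayley Y) i j / ?d - mat 1 $ i $ j"
      using inverse_entry(2)[OF cayley_mult(2), of Y i j] by (simp add: algebra_simps)
    have "h (cayley Y, B) = cnj ?d * ?d * skew Y $ i $ j"
      unfolding X using nz by (simp add: h_def field_simps)
    also have "cnj ?d * ?d = complex_of_real ((cmod ?d)\<^sup>2)"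
      by (simp only: complex_norm_square mult.commute)
    finally show "Re (h (cayley Y, B)) + Im (h (cayley Y, B)) = (cmod ?d)\<^sup>2 * Y $ i $ j"
      by (simp add: skew_recover[symmetric] distrib_left del: of_real_power)
  qed
  then show thesis
    by (intro that[OF f]) simp
qed

lemma real_algebraic_dim_fibre:
  fixes a b :: "'n::finite"
  assumes ab: "a \<noteq> b"
  shows "ereal (real (CARD('n) ^ 2 + 1)) \<le> real_algebraic_dim (phi -` {(0, swap_matrix a b)})"
proof -
  define N where "N = CARD('n) ^ 2"
  have "card (UNIV :: ('n \<times> 'n) set) = N"
    by (simp add: N_def power2_eq_square)
  then obtain e :: "nat \<Rightarrow> 'n \<times> 'n" where e: "bij_betw e {0..<N} UNIV"
    using ex_bij_betw_nat_finite[of "UNIV :: ('n \<times> 'n) set"] by auto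
  \<comment> \<open>For \<open>k \<le> N\<close> the first \<open>k\<close> entries of
    \<open>Y\<close> in the enumeration \<open>e\<close> are free and \<open>r = 1\<close>. The last
    set, at \<open>k = N + 1\<close>, also frees \<open>r\<close>.\<close>
  define T :: "nat \<Rightarrow> ((real^'n^'n) \<times> real) set" where
    "T k = {(Y, r). r > 0 \<and> (k \<le> N \<longrightarrow> r = 1) \<and>
       (\<forall>l<N. k \<le> l \<longrightarrow> Y $ fst (e l) $ snd (e l) = 0)}" for k
  have convT: "convex (T k)" for k
    unfolding convex_def T_def
    by (auto simp: add_pos_nonneg add_nonneg_pos) (smt (verit) mult_nonneg_nonneg mult_pos_pos)+
  show ?thesis
    unfolding N_def[symmetric]
  proof (rule real_algebraic_dim_ge[where Z = "\<lambda>k. fibre_point a b ` T k"])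
    fix k
    show "fibre_point a b ` T k \<subseteq> phi -` {(0, swap_matrix a b)}"
      using ab by (auto simp: T_def intro!: phi_fibre_point)
    have "(0, 1) \<in> T k"
      by (simp add: T_def)
    then show "fibre_point a b ` T k \<noteq> {}"
      by blast
    show "rationally_connected (fibre_point a b ` T k)"
      using convT by (rule rationally_connected_fibre_points) (auto simp: T_def)
    show "fibre_point a b ` T k \<subseteq> fibre_point a b ` T (Suc k)"
      by (intro image_mono) (auto simp: T_def)
    assume "k < N + 1"
    then consider "k < N" | "k = N"
      by linarith
    then show "\<exists>f. real_polynomial_function f \<and> (\<forall>z\<in>fibre_point a b ` T k. f z = 0) \<and>
        (\<exists>z\<in>fibre_point a b ` T (Suc k). f z \<noteq> 0)"
    proof cases
      case 1
      obtain f :: "(complex^'n^'n) \<times> (complex^'n^'n) \<Rightarrow> real"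
        where f: "real_polynomial_function f"
        "\<And>Y B. f (cayley Y, B) = 0 \<longleftrightarrow> Y $ fst (e k) $ snd (e k) = 0"
        using polynomial_cayley_coordinate[of "fst (e k)" "snd (e k)"] by metis
      \<comment> \<open>The matrix unit at position \<open>e k\<close>: it lies in the next
        parameter set, and exactly its newly freed coordinate is nonzero.\<close>
      define Y where "Y = (\<chi> i j. if (i, j) = e k then 1 else (0 :: real))"
      have Y: "Y $ fst (e l) $ snd (e l) = (if l = k then 1 else 0)" if "l < N" for l
        using e 1 that by (auto simp: Y_def bij_betw_def inj_on_def)
      have "(Y, 1) \<in> T (Suc k)"
        using 1 Y by (auto simp: T_def)
      moreover have "f (fibre_point a b (Y, 1)) \<noteq> 0"
        using f(2) Y[OF 1] by (simp add: fibre_point_def diagonal_scaling_1)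
      moreover have "\<forall>z\<in>fibre_point a b ` T k. f z = 0"
        using f(2) 1 by (auto simp: T_def fibre_point_def diagonal_scaling_1)
      ultimately show ?thesis
        using f(1) by blast
    next
      case 2
      \<comment> \<open>At a fibre point \<open>A* A = D D\<close>, whose entry at \<open>a\<close>
        is \<open>r^2\<close>; \<open>f\<close> therefore detects \<open>r = 1\<close> among
        positive \<open>r\<close>.\<close>
      define f :: "(complex^'n^'n) \<times> (complex^'n^'n) \<Rightarrow> real" where
        "f p = Re ((conj_transpose (fst p) ** fst p) $ a $ a) - 1" for p
      have "poly_fun.complexified
          (\<lambda>p :: (complex^'n^'n) \<times> (complex^'n^'n). (conj_transpose (fst p) ** fst p) $ a $ a)"
        by (intro poly_fun.complexified_matrix_mult poly_fun.complexified_conj_transpose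
            complexified_polynomial_entry bounded_linear_fst)
      then have f: "real_polynomial_function f"
        unfolding f_def poly_fun.complexified_def by (intro poly_fun.diff) auto
      have eval: "f (fibre_point a b (Y, r)) = r\<^sup>2 - 1" for Y r
      proof -
        let ?U = "cayley Y" and ?D = "diagonal_scaling a b r"
        have "conj_transpose (?U ** ?D) ** (?U ** ?D) = ?D ** (conj_transpose ?U ** ?U) ** ?D"
          by (simp add: conj_transpose_matrix_mult conj_transpose_diagonal_scaling matrix_mul_assoc)
        also have "\<dots> = ?D ** ?D"
          by (simp add: cayley_unitary)
        finally have "(conj_transpose (?U ** ?D) ** (?U ** ?D)) $ a $ a = complex_of_real (r * r)"
          by (simp add: diagonal_scaling_mult_nth) (simp add: diagonal_scaling_def)
        then show ?thesis
          by (simp add: f_def fibre_point_def power2_eq_square)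
      qed
      have "(0, 2) \<in> T (Suc k)"
        using 2 by (simp add: T_def)
      moreover have "f (fibre_point a b (0, 2)) \<noteq> 0"
        by (simp add: eval)
      moreover have "\<forall>z\<in>fibre_point a b ` T k. f z = 0"
        using 2 by (auto simp: T_def eval)
      ultimately show ?thesis
        using f by blast
    qed
  qed
qed

section \<open>Criticality\<close>

text \<open>Product rule, with conjugate transposition as a real-linear map. The explicit formula
  makes the range of the differential accessible.\<close>

lemma phi_has_derivative:
  fixes p :: "(complex^'n^'n) \<times> (complex^'n^'n)"
  shows "(phi has_derivative (\<lambda>h.
     (map_matrix (\<lambda>z. \<i> / 2 * z)
        ((conj_transpose (fst p) ** fst h + conj_transpose (fst h) ** fst p)
         - (snd p ** conj_transpose (snd h) + snd h ** conj_transpose (snd p))),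
      snd p ** fst h + snd h ** fst p))) (at p)"
proof -
  have lin: "bounded_linear (map_matrix (\<lambda>z. \<i> / 2 * z) :: complex^'n^'n \<Rightarrow> complex^'n^'n)"
    by (simp add: linear_conv_bounded_linear[symmetric] linear_iff vec_eq_iff algebra_simps)
  have phi: "phi = (\<lambda>p. (map_matrix (\<lambda>z. \<i> / 2 * z)
      (conj_transpose (fst p) ** fst p - snd p ** conj_transpose (snd p)), snd p ** fst p))"
    by (simp add: phi_def fun_eq_iff split: prod.split)
  have star: "((\<lambda>p. conj_transpose (g p)) has_derivative (\<lambda>h. conj_transpose (g' h))) (at p)"
    if "(g has_derivative g') (at p)"
    for g g' :: "(complex^'n^'n) \<times> (complex^'n^'n) \<Rightarrow> complex^'n^'n"
    by (rule bounded_linear.has_derivative[OF bounded_linear_conj_transpose that])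
  have fs: "(fst has_derivative fst) (at p)" "(snd has_derivative snd) (at p)"
    by (intro bounded_linear_imp_has_derivative bounded_linear_fst bounded_linear_snd)+
  show ?thesis
    unfolding phi
    by (intro has_derivative_Pair bounded_linear.has_derivative[OF lin] has_derivative_diff
        matmul.FDERIV star fs)
qed

text \<open>At \<open>(1, S)\<close> the image of the differential misses \<open>(H, 0)\<close> for every diagonal \<open>H\<close> whose entries
  at \<open>a\<close> and \<open>b\<close> differ: when the second component vanishes, the first one is
  \<open>\<i>/2 (M + S M S)\<close> with \<open>M = dA + dA*\<close>, and conjugation by \<open>S\<close> exchanges these two entries.\<close>

lemma critical_point_swap:
  fixes a b :: "'n::finite"
  assumes ab: "a \<noteq> b"
  shows "critical_point (unitary_algebra \<times> UNIV) phi (mat 1, swap_matrix a b)"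
proof -
  let ?S = "swap_matrix a b"
  \<comment> \<open>A skew-Hermitian diagonal matrix with entry \<open>\<i>\<close> at
    \<open>a\<close> and 0 at \<open>b\<close>.\<close>
  define H :: "complex^'n^'n" where "H = (\<chi> i j. if i = a \<and> j = a then \<i> else 0)"
  have "(H, 0) \<in> unitary_algebra \<times> UNIV"
    by (simp add: H_def unitary_algebra_def vec_eq_iff)
  moreover have "(H, 0) \<notin> range (frechet_derivative phi (at (mat 1, ?S)))"
  proof
    assume "(H, 0) \<in> range (frechet_derivative phi (at (mat 1, ?S)))"
    then obtain h where h: "(H, 0) =
        (map_matrix (\<lambda>z. \<i> / 2 * z)
          ((conj_transpose (mat 1) ** fst h + conj_transpose (fst h) ** mat 1)
           - (?S ** conj_transpose (snd h) + snd h ** conj_transpose ?S)),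
         ?S ** fst h + snd h ** mat 1)"
      unfolding frechet_derivative_at[OF phi_has_derivative, symmetric] fst_conv snd_conv by blast
    define X Y where "X = fst h" and "Y = snd h"
    have H: "H = map_matrix (\<lambda>z. \<i> / 2 * z)
        ((X + conj_transpose X) - (?S ** conj_transpose Y + Y ** ?S))"
      and 0: "?S ** X + Y = 0"
      using h by (simp_all add: X_def Y_def conj_transpose_swap_matrix)
    have Y: "Y = - (?S ** X)"
      using 0 by (simp add: add_eq_0_iff)
    have "?S ** conj_transpose Y = - (?S ** conj_transpose X ** ?S)" "Y ** ?S = - (?S ** X ** ?S)"
      unfolding Y
      by (simp_all add: vec_eq_iff swap_matrix_mult_nth)
    \<comment> \<open>The right-hand side is unchanged when \<open>i\<close> is replaced by its
      image under the transposition, which forces the entries of \<open>H\<close> at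
      \<open>a\<close> and \<open>b\<close> to agree.\<close>
    then have diag: "H $ i $ i = \<i> / 2 * (X $ i $ i + cnj (X $ i $ i)
        + (X $ Transposition.transpose a b i $ Transposition.transpose a b i
        + cnj (X $ Transposition.transpose a b i $ Transposition.transpose a b i)))" for i
      unfolding H by (simp add: swap_matrix_mult_nth algebra_simps)
    have "H $ a $ a = H $ b $ b"
      unfolding diag by (simp add: add.commute)
    then show False
      using ab by (simp add: H_def)
  qed
  moreover have "phi differentiable (at (mat 1, ?S))"
    using phi_has_derivative unfolding differentiable_def by blast
  ultimately show ?thesis
    unfolding critical_point_def by blast
qed

theorem theorem4p5:
  assumes "CARD('n::finite) > 1"
  shows "\<exists>S :: complex^'n^'n.
           invertible S \<and>
           (0, S) \<in> critical_values (unitary_algebra \<times> UNIV) phi \<and>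
           real_algebraic_dim (phi -` {(0, S)}) > ereal (real (CARD('n) ^ 2))"
proof -
  obtain a b :: 'n where ab: "a \<noteq> b"
    using assms by (metis (full_types) One_nat_def card_1_singleton_iff UNIV_I UNIV_eq_I
        less_irrefl singletonI)
  have "invertible (swap_matrix a b)"
    unfolding invertible_def using swap_matrix_square by blast
  \<comment> \<open>The critical point lies in the same fibre: it is the member of the family with
    \<open>U = 1\<close> and \<open>r = 1\<close>.\<close>
  moreover have "phi (mat 1, swap_matrix a b) = (0, swap_matrix a b)"
    by (simp add: phi_def conj_transpose_swap_matrix swap_matrix_square vec_eq_iff)
  then have "(0, swap_matrix a b) \<in> critical_values (unitary_algebra \<times> UNIV) phi"
    unfolding critical_values_def using critical_point_swap[OF ab] by force
  moreover have "ereal (real (CARD('n) ^ 2)) < real_algebraic_dim (phi -` {(0, swap_matrix a b)})"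
    using real_algebraic_dim_fibre[OF ab] by (rule less_le_trans[rotated]) simp
  ultimately show ?thesis
    by blast
qed

end
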